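(* Let $B$ be a ring, and suppose there exist a family $(R_i)_{i\in I}$ of rings and a surjective ring homomorphism $f:\prod_{i\in I}R_i\to B$ such that the induced homomorphism $\pi f:\prod_{i\in I}R_i\to B/Z(B)$ does not factor through the natural map from $\prod_{i\in I}R_i$ to any finite product of ultraproducts of the $R_i$. Then $B$ contains families of elements $(a_S)$, $(b_S)$, indexed by the subsets $S\subseteq\omega$, such that: (i) All the elements $a_S$ $(S\subseteq\omega)$ commute with one another, and all the elements $b_S$ likewise commute with one another. (ii) For disjoint subsets $S$ and $T$ of $\omega$, we have $a_S+a_T=a_{S\cup T}$, $b_S+b_T=b_{S\cup T}$, and $0=a_S\,a_T=a_S\,b_T=b_S\,a_T=b_S\,b_T$. (iii) For subsets $S$ and $T$ of $\omega$ with $\mathrm{card}(S\cap T)=1$, we have $a_S\,b_T\neq 0$.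
   Context: Here a ring means an abelian group given with an arbitrary bilinear multiplication (not necessarily associative, commutative or unital). $Z(B)=\{b\in B\mid bB=Bb=\{0\}\}$ is the zero-multiplication ideal of $B$, and $\pi:B\to B/Z(B)$ is the quotient map. A homomorphism on $\prod_{i\in I}R_i$ factors through the natural map to a finite product of ultraproducts if, for some finite (possibly empty) family of ultrafilters $\mathcal U_0,\dots,\mathcal U_{n-1}$ on $I$ (principal or not), it is the composite of the natural map $\prod_{i\in I}R_i\to\prod_{i\in I}R_i/\mathcal U_0\times\dots\times\prod_{i\in I}R_i/\mathcal U_{n-1}$ with a homomorphism defined on that product. *)

theory Defs
  imports "HOL-Algebra.QuotRing" "HOL-Library.FuncSet"
begin

text \<open>
  Rings here are neither associative, commutative nor unital. The record type \<open>ring\<close> of the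
  library is used as a carrier of the operations; its field \<open>one\<close> is unconstrained and plays no role
  (in particular, it need not be preserved by homomorphisms, so \<open>ring_hom\<close> is not used).
\<close>

locale nonassoc_ring = abelian_group R for R (structure) +
  assumes m_closed [simp, intro]:
      "\<lbrakk>x \<in> carrier R; y \<in> carrier R\<rbrakk> \<Longrightarrow> x \<otimes> y \<in> carrier R"
    and l_distr: "\<lbrakk>x \<in> carrier R; y \<in> carrier R; z \<in> carrier R\<rbrakk>
      \<Longrightarrow> (x \<oplus> y) \<otimes> z = x \<otimes> z \<oplus> y \<otimes> z"
    and r_distr: "\<lbrakk>x \<in> carrier R; y \<in> carrier R; z \<in> carrier R\<rbrakk>
      \<Longrightarrow> z \<otimes> (x \<oplus> y) = z \<otimes> x \<oplus> z \<otimes> y"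

definition nonassoc_ring_hom ::
    "('a, 'm) ring_scheme \<Rightarrow> ('b, 'n) ring_scheme \<Rightarrow> ('a \<Rightarrow> 'b) set" where
  "nonassoc_ring_hom R S = {h \<in> carrier R \<rightarrow> carrier S. \<forall>x\<in>carrier R. \<forall>y\<in>carrier R.
     h (x \<oplus>\<^bsub>R\<^esub> y) = h x \<oplus>\<^bsub>S\<^esub> h y \<and> h (x \<otimes>\<^bsub>R\<^esub> y) = h x \<otimes>\<^bsub>S\<^esub> h y}"

definition zero_mult_ideal :: "('a, 'm) ring_scheme \<Rightarrow> 'a set" where
  "zero_mult_ideal B =
     {b \<in> carrier B. \<forall>x\<in>carrier B. b \<otimes>\<^bsub>B\<^esub> x = \<zero>\<^bsub>B\<^esub> \<and> x \<otimes>\<^bsub>B\<^esub> b = \<zero>\<^bsub>B\<^esub>}"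

definition ring_product :: "'i set \<Rightarrow> ('i \<Rightarrow> ('a, 'm) ring_scheme) \<Rightarrow> ('i \<Rightarrow> 'a) ring" where
  "ring_product I R =
     \<lparr>carrier = (\<Pi>\<^sub>E i\<in>I. carrier (R i)),
      mult = (\<lambda>x y. \<lambda>i\<in>I. x i \<otimes>\<^bsub>R i\<^esub> y i),
      one = (\<lambda>i\<in>I. \<one>\<^bsub>R i\<^esub>),
      zero = (\<lambda>i\<in>I. \<zero>\<^bsub>R i\<^esub>),
      add = (\<lambda>x y. \<lambda>i\<in>I. x i \<oplus>\<^bsub>R i\<^esub> y i)\<rparr>"

text \<open>
  An ultrafilter on the set \<open>I\<close> is represented by a filter on the ambient type that contains \<open>I\<close>;
  its members as a filter on \<open>I\<close> are the \<open>A \<subseteq> I\<close> with \<open>eventually (\<lambda>i. i \<in> A) U\<close>. Principal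
  ultrafilters are allowed.
\<close>

definition ultrafilter_on :: "'i set \<Rightarrow> 'i filter \<Rightarrow> bool" where
  "ultrafilter_on I U \<longleftrightarrow> eventually (\<lambda>i. i \<in> I) U \<and> U \<noteq> bot \<and>
     (\<forall>A\<subseteq>I. eventually (\<lambda>i. i \<in> A) U \<or> eventually (\<lambda>i. i \<in> I - A) U)"

definition ultra_null :: "'i set \<Rightarrow> ('i \<Rightarrow> ('a, 'm) ring_scheme) \<Rightarrow> 'i filter \<Rightarrow> ('i \<Rightarrow> 'a) set" where
  "ultra_null I R U = {x \<in> carrier (ring_product I R). eventually (\<lambda>i. x i = \<zero>\<^bsub>R i\<^esub>) U}"

text \<open>
  \<open>Quot\<close> only uses cosets, so it makes sense for the rings considered here; that the cosets
  of \<open>ultra_null\<close> are the classes of equality almost everywhere is \<open>ultra_null_coset_eq_iff\<close> below.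
\<close>

definition ultraproduct ::
    "'i set \<Rightarrow> ('i \<Rightarrow> ('a, 'm) ring_scheme) \<Rightarrow> 'i filter \<Rightarrow> ('i \<Rightarrow> 'a) set ring" where
  "ultraproduct I R U = ring_product I R Quot ultra_null I R U"

definition ultraproducts_map ::
    "'i set \<Rightarrow> ('i \<Rightarrow> ('a, 'm) ring_scheme) \<Rightarrow> nat \<Rightarrow> (nat \<Rightarrow> 'i filter)
      \<Rightarrow> ('i \<Rightarrow> 'a) \<Rightarrow> nat \<Rightarrow> ('i \<Rightarrow> 'a) set" where
  "ultraproducts_map I R n U x =
     (\<lambda>j\<in>{..<n}. ultra_null I R (U j) +>\<^bsub>ring_product I R\<^esub> x)"

definition factors_through_ultraproducts ::
    "'i set \<Rightarrow> ('i \<Rightarrow> ('a, 'm) ring_scheme) \<Rightarrow> ('c, 'n) ring_scheme \<Rightarrow> (('i \<Rightarrow> 'a) \<Rightarrow> 'c) \<Rightarrow> bool" where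
  "factors_through_ultraproducts I R C h \<longleftrightarrow>
     (\<exists>n U. (\<forall>j<n. ultrafilter_on I (U j)) \<and>
        (\<exists>g \<in> nonassoc_ring_hom (ring_product {..<n} (\<lambda>j. ultraproduct I R (U j))) C.
           \<forall>x \<in> carrier (ring_product I R). h x = g (ultraproducts_map I R n U x)))"

lemma ring_product_nonassoc_ring:
  assumes "\<And>i. i \<in> I \<Longrightarrow> nonassoc_ring (R i)"
  shows "nonassoc_ring (ring_product I R)"
proof -
  have ag: "abelian_group (R i)" if "i \<in> I" for i
    using assms[OF that] by (simp add: nonassoc_ring_def)
  have am: "abelian_monoid (R i)" if "i \<in> I" for i
    using ag[OF that] by (simp add: abelian_group_def)
  show ?thesis
  proof (intro nonassoc_ring.intro abelian_groupI nonassoc_ring_axioms.intro)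
    fix x assume x: "x \<in> carrier (ring_product I R)"
    show "\<exists>y\<in>carrier (ring_product I R). y \<oplus>\<^bsub>ring_product I R\<^esub> x = \<zero>\<^bsub>ring_product I R\<^esub>"
    proof
      show "(\<lambda>i\<in>I. \<ominus>\<^bsub>R i\<^esub> x i) \<oplus>\<^bsub>ring_product I R\<^esub> x = \<zero>\<^bsub>ring_product I R\<^esub>"
        using x by (auto simp: ring_product_def PiE_iff abelian_group.l_neg[OF ag] intro!: restrict_ext)
      show "(\<lambda>i\<in>I. \<ominus>\<^bsub>R i\<^esub> x i) \<in> carrier (ring_product I R)"
        using x by (auto simp: ring_product_def PiE_iff abelian_group.a_inv_closed[OF ag])
    qed
  qed (auto simp: ring_product_def PiE_iff abelian_monoid.a_closed[OF am] abelian_monoid.zero_closed[OF am]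
        abelian_monoid.a_assoc[OF am] abelian_monoid.l_zero[OF am] nonassoc_ring.m_closed[OF assms]
        nonassoc_ring.l_distr[OF assms] nonassoc_ring.r_distr[OF assms]
        intro!: restrict_ext abelian_monoid.a_comm[OF am] extensionalityI[of _ I])
qed

lemma ultra_null_coset_eq_iff:
  assumes R: "\<And>i. i \<in> I \<Longrightarrow> nonassoc_ring (R i)" and U: "ultrafilter_on I U"
    and x: "x \<in> carrier (ring_product I R)" and y: "y \<in> carrier (ring_product I R)"
  shows "ultra_null I R U +>\<^bsub>ring_product I R\<^esub> x = ultra_null I R U +>\<^bsub>ring_product I R\<^esub> y
     \<longleftrightarrow> eventually (\<lambda>i. x i = y i) U"
proof -
  let ?P = "ring_product I R"
  have ag: "abelian_group (R i)" if "i \<in> I" for i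
    using R[OF that] by (simp add: nonassoc_ring_def)
  have am: "abelian_monoid (R i)" if "i \<in> I" for i
    using ag[OF that] by (simp add: abelian_group_def)
  interpret P: nonassoc_ring ?P
    using ring_product_nonassoc_ring[of I R] R by blast
  have inI: "eventually (\<lambda>i. i \<in> I) U"
    using U by (simp add: ultrafilter_on_def)
  have mem: "z i \<in> carrier (R i)" if "z \<in> carrier ?P" "i \<in> I" for z i
    using that by (auto simp: ring_product_def)
  have add: "(z \<oplus>\<^bsub>?P\<^esub> w) i = z i \<oplus>\<^bsub>R i\<^esub> w i" if "i \<in> I" for z w i
    using that by (simp add: ring_product_def)
  have zero: "\<zero>\<^bsub>?P\<^esub> i = \<zero>\<^bsub>R i\<^esub>" if "i \<in> I" for i
    using that by (simp add: ring_product_def)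
  have neg: "(\<ominus>\<^bsub>?P\<^esub> z) i = \<ominus>\<^bsub>R i\<^esub> z i" if z: "z \<in> carrier ?P" and i: "i \<in> I" for z i
  proof -
    have "(\<ominus>\<^bsub>?P\<^esub> z) i \<oplus>\<^bsub>R i\<^esub> z i = \<zero>\<^bsub>R i\<^esub>"
      using P.l_neg[OF z] add[OF i, of "\<ominus>\<^bsub>?P\<^esub> z" z] zero[OF i] by simp
    then show ?thesis
      using abelian_group.minus_equality[OF ag[OF i]] mem[OF _ i] z P.a_inv_closed[OF z] by metis
  qed
  have coset: "ultra_null I R U +>\<^bsub>?P\<^esub> z = {w \<in> carrier ?P. eventually (\<lambda>i. w i = z i) U}"
    if z: "z \<in> carrier ?P" for z
  proof (intro equalityI subsetI)
    fix w assume "w \<in> ultra_null I R U +>\<^bsub>?P\<^esub> z"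
    then obtain h where h: "h \<in> carrier ?P" "eventually (\<lambda>i. h i = \<zero>\<^bsub>R i\<^esub>) U"
      and w: "w = h \<oplus>\<^bsub>?P\<^esub> z"
      by (auto simp: a_r_coset_def' ultra_null_def)
    have "eventually (\<lambda>i. w i = z i) U"
      using h(2) inI by eventually_elim
        (simp add: w add mem[OF z] abelian_monoid.l_zero[OF am])
    then show "w \<in> {w \<in> carrier ?P. eventually (\<lambda>i. w i = z i) U}"
      using h z w by simp
  next
    fix w assume w: "w \<in> {w \<in> carrier ?P. eventually (\<lambda>i. w i = z i) U}"
    then have wc: "w \<in> carrier ?P" and ev: "eventually (\<lambda>i. w i = z i) U" by auto
    let ?h = "w \<oplus>\<^bsub>?P\<^esub> \<ominus>\<^bsub>?P\<^esub> z"
    have "eventually (\<lambda>i. ?h i = \<zero>\<^bsub>R i\<^esub>) U"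
      using ev inI by eventually_elim
        (simp add: add neg[OF z] mem[OF z] abelian_group.r_neg[OF ag])
    then have "?h \<in> ultra_null I R U"
      using wc z by (simp add: ultra_null_def)
    moreover have "w = ?h \<oplus>\<^bsub>?P\<^esub> z"
      using wc z by (simp add: P.a_assoc P.l_neg)
    ultimately show "w \<in> ultra_null I R U +>\<^bsub>?P\<^esub> z"
      by (auto simp: a_r_coset_def')
  qed
  show ?thesis
  proof
    assume eq: "ultra_null I R U +>\<^bsub>?P\<^esub> x = ultra_null I R U +>\<^bsub>?P\<^esub> y"
    have "x \<in> ultra_null I R U +>\<^bsub>?P\<^esub> x"
      using x by (simp add: coset)
    then show "eventually (\<lambda>i. x i = y i) U"
      using eq y by (simp add: coset)
  next
    assume "eventually (\<lambda>i. x i = y i) U"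
    then have "eventually (\<lambda>i. w i = x i) U \<longleftrightarrow> eventually (\<lambda>i. w i = y i) U" for w
      by (intro eventually_cong) (auto elim: eventually_mono)
    then show "ultra_null I R U +>\<^bsub>?P\<^esub> x = ultra_null I R U +>\<^bsub>?P\<^esub> y"
      using x y by (simp add: coset)
  qed
qed

end

theory Submission
  imports Defs "HOL-Library.Disjoint_Sets"
begin

text \<open>
  Elements of the product with disjoint supports multiply to zero. Hence, if \<open>X n\<close> and \<open>Y n\<close> are
  supported on pairwise disjoint sets \<open>D n\<close> and \<open>f (X n) f (Y n) \<noteq> 0\<close> for all \<open>n\<close>, the images under
  \<open>f\<close> of the infinite sums \<open>\<Sum>n\<in>S. X n\<close> and \<open>\<Sum>n\<in>S. Y n\<close> (which make sense coordinatewise) are the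
  required \<open>a\<^sub>S\<close> and \<open>b\<^sub>S\<close>: a product of two such sums, over \<open>S\<close> and over \<open>T\<close>, only sees the terms with
  index in \<open>S \<inter> T\<close>. This gives commutativity and the vanishing for disjoint \<open>S\<close> and \<open>T\<close>, and reduces the case
  \<open>S \<inter> T = {n}\<close> to \<open>f (X n) f (Y n)\<close> (\<open>glue_mult_commute\<close>, \<open>glue_mult_disjoint\<close>, \<open>glue_mult_singleton\<close>).

  To find the \<open>D n\<close>, call a set \<open>A\<close> of indices null if \<open>f\<close> sends the elements supported on \<open>A\<close> into
  \<open>Z(B)\<close>. The null sets form an ideal \<open>F\<close> of sets, and every set \<open>A\<close> that is not null carries \<open>x\<close> and
  \<open>y\<close> with \<open>f x f y \<noteq> 0\<close>: some product of \<open>f x \<notin> Z(B)\<close> with some \<open>f y\<close> is nonzero, and \<open>y\<close> may be cut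
  down to \<open>A\<close> without changing the product (\<open>not_null_obtains_product\<close>). So an infinite disjoint
  sequence of sets that are not null suffices.

  If no such sequence exists, the Boolean algebra of subsets of \<open>I\<close> modulo \<open>F\<close> is finite, so up to a null set
  \<open>I\<close> is a disjoint union of finitely many atoms (\<open>splits_into_atoms_or_disjoint_sequence\<close>). Each
  atom gives an ultrafilter, and two elements of the product that agree almost everywhere for each of
  these ultrafilters differ only on a null set, hence have the same image in \<open>B/Z(B)\<close>. As
  the product maps onto the product of the ultraproducts, \<open>\<pi> f\<close> factors through it
  (\<open>factors_if_splits_into_atoms\<close>), contrary to the hypothesis.
\<close>

section \<open>Quotients and homomorphisms of nonassociative rings\<close>

context nonassoc_ring
begin

lemma l_null [simp]: "x \<in> carrier R \<Longrightarrow> \<zero> \<otimes> x = \<zero>"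
  using l_distr[of \<zero> \<zero> x] by simp

lemma r_null [simp]: "x \<in> carrier R \<Longrightarrow> x \<otimes> \<zero> = \<zero>"
  using r_distr[of \<zero> \<zero> x] by simp

lemma additive_subgroupI:
  assumes "N \<subseteq> carrier R" "\<zero> \<in> N"
    and "\<And>x y. x \<in> N \<Longrightarrow> y \<in> N \<Longrightarrow> x \<oplus> y \<in> N"
    and "\<And>x. x \<in> N \<Longrightarrow> \<ominus> x \<in> N"
  shows "additive_subgroup N R"
proof (intro additive_subgroup.intro add.subgroupI)
  show "N \<noteq> {}" using assms(2) by auto
qed (use assms in \<open>auto simp: a_inv_def[symmetric]\<close>)

text \<open>
  Multiplication of cosets is well defined because, by distributivity, \<open>(n + x)(m + y)\<close> differs from
  \<open>x y\<close> by \<open>n m + n y + x m\<close>.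
\<close>

lemma coset_map_hom:
  assumes N: "additive_subgroup N R"
    and absorb_left: "\<And>x n. x \<in> carrier R \<Longrightarrow> n \<in> N \<Longrightarrow> x \<otimes> n \<in> N"
    and absorb_right: "\<And>x n. x \<in> carrier R \<Longrightarrow> n \<in> N \<Longrightarrow> n \<otimes> x \<in> N"
  shows "(\<lambda>x. N +> x) \<in> nonassoc_ring_hom R (R Quot N)"
proof -
  interpret N: abelian_subgroup N R
    using N abelian_group_axioms by (rule abelian_subgroupI3)
  have mult: "rcoset_mult R N (N +> x) (N +> y) = N +> (x \<otimes> y)"
    if x: "x \<in> carrier R" and y: "y \<in> carrier R" for x y
  proof -
    have rep: "N +> (x' \<otimes> y') = N +> (x \<otimes> y)" if x': "x' \<in> N +> x" and y': "y' \<in> N +> y" for x' y'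
    proof -
      obtain n m where n: "n \<in> N" "x' = n \<oplus> x" and m: "m \<in> N" "y' = m \<oplus> y"
        using x' y' by (auto simp: a_r_coset_def')
      have nm: "n \<in> carrier R" "m \<in> carrier R"
        using n m N.a_subset by auto
      have "x' \<otimes> y' = (n \<otimes> m \<oplus> n \<otimes> y \<oplus> x \<otimes> m) \<oplus> x \<otimes> y"
        using nm x y by (simp add: n m l_distr r_distr a_ac)
      moreover have "n \<otimes> m \<oplus> n \<otimes> y \<oplus> x \<otimes> m \<in> N"
        using nm x y n m absorb_left absorb_right by (intro N.a_closed) auto
      ultimately have "x' \<otimes> y' \<in> N +> (x \<otimes> y)"
        by (auto simp: a_r_coset_def')
      then show ?thesis
        using N.a_repr_independence' x y by (metis m_closed)
    qed
    have "x \<in> N +> x" "y \<in> N +> y"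
      using x y N.a_rcos_self by auto
    then show ?thesis
      unfolding rcoset_mult_def using rep by blast
  qed
  show ?thesis
    by (auto simp: nonassoc_ring_hom_def FactRing_def mult N.a_rcos_sum A_RCOSETS_def')
qed

lemma zero_mult_ideal_additive_subgroup: "additive_subgroup (zero_mult_ideal R) R"
proof (rule additive_subgroupI)
  show "\<ominus> x \<in> zero_mult_ideal R" if "x \<in> zero_mult_ideal R" for x
  proof -
    have x: "x \<in> carrier R" "\<And>y. y \<in> carrier R \<Longrightarrow> x \<otimes> y = \<zero> \<and> y \<otimes> x = \<zero>"
      using that by (auto simp: zero_mult_ideal_def)
    have "\<ominus> x \<otimes> y = \<zero> \<and> y \<otimes> \<ominus> x = \<zero>" if y: "y \<in> carrier R" for y
    proof
      have "\<ominus> x \<otimes> y = \<ominus> x \<otimes> y \<oplus> x \<otimes> y" "y \<otimes> \<ominus> x = y \<otimes> \<ominus> x \<oplus> y \<otimes> x"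
        using x(1) x(2)[OF y] y by simp_all
      then show "\<ominus> x \<otimes> y = \<zero>" "y \<otimes> \<ominus> x = \<zero>"
        using x(1) y by (simp_all add: l_distr[symmetric] r_distr[symmetric] l_neg)
    qed
    then show ?thesis using x by (simp add: zero_mult_ideal_def)
  qed
qed (auto simp: zero_mult_ideal_def l_distr r_distr)

lemma zero_mult_ideal_coset_hom:
  "(\<lambda>x. zero_mult_ideal R +> x) \<in> nonassoc_ring_hom R (R Quot zero_mult_ideal R)"
  by (rule coset_map_hom[OF zero_mult_ideal_additive_subgroup]) (auto simp: zero_mult_ideal_def)

end

lemma nonassoc_ring_hom_comp:
  "g \<in> nonassoc_ring_hom R S \<Longrightarrow> h \<in> nonassoc_ring_hom S T \<Longrightarrow> (\<lambda>x. h (g x)) \<in> nonassoc_ring_hom R T"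
  by (auto simp: nonassoc_ring_hom_def Pi_iff)

text \<open>
  The homomorphism theorem, for a map \<open>q\<close> that need not be given as a coset map: it is applied below with
  \<open>q\<close> the natural map to a product of ultraproducts.
\<close>

lemma nonassoc_ring_hom_factor:
  assumes R: "nonassoc_ring R"
    and q: "q \<in> nonassoc_ring_hom R Q" and onto: "q ` carrier R = carrier Q"
    and h: "h \<in> nonassoc_ring_hom R C"
    and wd: "\<And>x y. x \<in> carrier R \<Longrightarrow> y \<in> carrier R \<Longrightarrow> q x = q y \<Longrightarrow> h x = h y"
  shows "\<exists>g \<in> nonassoc_ring_hom Q C. \<forall>x \<in> carrier R. h x = g (q x)"
proof -
  interpret nonassoc_ring R by (rule R)
  define g where "g z = h (inv_into (carrier R) q z)" for z
  have g: "g (q x) = h x" if "x \<in> carrier R" for x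
    unfolding g_def using that by (intro wd) (simp_all add: inv_into_into f_inv_into_f)
  have "g \<in> nonassoc_ring_hom Q C"
    unfolding nonassoc_ring_hom_def onto[symmetric]
  proof (safe; (elim imageE)?)
    fix x assume x: "x \<in> carrier R"
    show "g (q x) \<in> carrier C"
      using h x by (auto simp: nonassoc_ring_hom_def g)
    fix y assume y: "y \<in> carrier R"
    have "g (q x \<oplus>\<^bsub>Q\<^esub> q y) = g (q (x \<oplus>\<^bsub>R\<^esub> y))" "g (q x \<otimes>\<^bsub>Q\<^esub> q y) = g (q (x \<otimes>\<^bsub>R\<^esub> y))"
      using q x y by (simp_all add: nonassoc_ring_hom_def)
    then show "g (q x \<oplus>\<^bsub>Q\<^esub> q y) = g (q x) \<oplus>\<^bsub>C\<^esub> g (q y)" "g (q x \<otimes>\<^bsub>Q\<^esub> q y) = g (q x) \<otimes>\<^bsub>C\<^esub> g (q y)"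
      using h x y by (simp_all add: nonassoc_ring_hom_def g)
  qed
  then show ?thesis
    using g by (intro bexI[of _ g]) simp_all
qed

section \<open>Atoms of the subsets of a set modulo an ideal of sets\<close>

locale set_ideal =
  fixes F :: "'i set set"
  assumes empty_mem [simp, intro]: "{} \<in> F"
    and subset_mem: "A \<in> F \<Longrightarrow> B \<subseteq> A \<Longrightarrow> B \<in> F"
    and union_mem: "A \<in> F \<Longrightarrow> B \<in> F \<Longrightarrow> A \<union> B \<in> F"
begin

lemma finite_Union_mem: "finite \<A> \<Longrightarrow> \<A> \<subseteq> F \<Longrightarrow> \<Union>\<A> \<in> F"
  by (induction rule: finite_induct) (auto intro: union_mem)

definition atom :: "'i set \<Rightarrow> bool" where
  "atom A \<longleftrightarrow> A \<notin> F \<and> (\<forall>C\<subseteq>A. C \<in> F \<or> A - C \<in> F)"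

text \<open>
  The atoms are subsets of \<open>A\<close> so that disjointness of sets carries over to their atoms.
\<close>

definition splits_into_atoms :: "'i set \<Rightarrow> bool" where
  "splits_into_atoms A \<longleftrightarrow>
     (\<exists>\<A>. finite \<A> \<and> disjoint \<A> \<and> \<Union>\<A> \<subseteq> A \<and> (\<forall>E\<in>\<A>. atom E) \<and> A - \<Union>\<A> \<in> F)"

lemma splits_into_atoms_union:
  assumes "splits_into_atoms A" "splits_into_atoms C" "A \<inter> C = {}"
  shows "splits_into_atoms (A \<union> C)"
proof -
  obtain \<A> where \<A>: "finite \<A>" "disjoint \<A>" "\<Union>\<A> \<subseteq> A" "\<forall>E\<in>\<A>. atom E" "A - \<Union>\<A> \<in> F"
    using assms(1) unfolding splits_into_atoms_def by blast
  obtain \<C> where \<C>: "finite \<C>" "disjoint \<C>" "\<Union>\<C> \<subseteq> C" "\<forall>E\<in>\<C>. atom E" "C - \<Union>\<C> \<in> F"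
    using assms(2) unfolding splits_into_atoms_def by blast
  have "disjoint (\<A> \<union> \<C>)"
  proof (intro disjoint_union)
    show "\<Union>\<A> \<inter> \<Union>\<C> = {}"
      using \<A>(3) \<C>(3) assms(3) by blast
  qed (use \<A> \<C> in auto)
  moreover have "A \<union> C - \<Union>(\<A> \<union> \<C>) \<in> F"
    by (rule subset_mem[OF union_mem[OF \<A>(5) \<C>(5)]]) auto
  ultimately show ?thesis
    unfolding splits_into_atoms_def using \<A> \<C> by (intro exI[of _ "\<A> \<union> \<C>"]) auto
qed

lemma mem_splits_into_atoms: "A \<in> F \<Longrightarrow> splits_into_atoms A"
  unfolding splits_into_atoms_def by (intro exI[of _ "{}"]) (auto simp: disjoint_def)

lemma atom_splits_into_atoms: "atom A \<Longrightarrow> splits_into_atoms A"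
  unfolding splits_into_atoms_def by (intro exI[of _ "{A}"]) (auto simp: disjoint_def)

text \<open>
  A set that does not split into atoms is neither in \<open>F\<close> nor an atom, so it falls into two parts
  outside \<open>F\<close>; they cannot both split into atoms, and the other part is what is cut off.
\<close>

lemma not_splits_into_atoms_shrink:
  assumes "\<not> splits_into_atoms A"
  shows "\<exists>C\<subseteq>A. \<not> splits_into_atoms C \<and> A - C \<notin> F"
proof -
  obtain C where C: "C \<subseteq> A" "C \<notin> F" "A - C \<notin> F"
    using assms mem_splits_into_atoms atom_splits_into_atoms unfolding atom_def by blast
  have "\<not> splits_into_atoms C \<or> \<not> splits_into_atoms (A - C)"
    using splits_into_atoms_union[of C "A - C"] assms C(1) by (auto simp: Un_absorb1)
  then show ?thesis
    using C by (metis Diff_subset double_diff order_refl)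
qed

text \<open>
  Shrinking a set that does not split into atoms again and again gives a descending sequence; its
  successive differences are the disjoint sets.
\<close>

lemma splits_into_atoms_or_disjoint_sequence:
  "splits_into_atoms A \<or> (\<exists>D :: nat \<Rightarrow> 'i set. disjoint_family D \<and> (\<forall>n. D n \<subseteq> A \<and> D n \<notin> F))"
proof (cases "splits_into_atoms A")
  case False
  have "\<exists>C :: nat \<Rightarrow> 'i set. C 0 = A \<and> (\<forall>n. \<not> splits_into_atoms (C n) \<and> (C (Suc n) \<subseteq> C n \<and> C n - C (Suc n) \<notin> F))"
    using dependent_nat_choice[of "\<lambda>n C. \<not> splits_into_atoms C \<and> (n = 0 \<longrightarrow> C = A)"
        "\<lambda>n C C'. C' \<subseteq> C \<and> C - C' \<notin> F"] not_splits_into_atoms_shrink False by (metis nat.distinct(2))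
  then obtain C where C: "C 0 = A" "\<And>n. C (Suc n) \<subseteq> C n" "\<And>n. C n - C (Suc n) \<notin> F"
    by blast
  have anti: "C n \<subseteq> C m" if "m \<le> n" for m n :: nat
    using lift_Suc_antimono_le[of C, OF C(2) that] .
  have "disjoint_family (\<lambda>n. C n - C (Suc n))"
    unfolding disjoint_family_on_def
  proof (intro ballI impI)
    fix m n :: nat assume "m \<noteq> n"
    then have "Suc m \<le> n \<or> Suc n \<le> m" by linarith
    then show "(C m - C (Suc m)) \<inter> (C n - C (Suc n)) = {}"
      using anti by blast
  qed
  moreover have "C n - C (Suc n) \<subseteq> A" for n
    using anti[of 0 n] C(1) by auto
  ultimately show ?thesis
    using C(3) by (intro disjI2 exI[of _ "\<lambda>n. C n - C (Suc n)"]) auto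
qed simp

text \<open>The sets whose trace on \<open>E\<close> is all of \<open>E\<close> modulo \<open>F\<close>.\<close>

definition atom_filter :: "'i set \<Rightarrow> 'i filter" where
  "atom_filter E = Abs_filter (\<lambda>P. {i \<in> E. \<not> P i} \<in> F)"

lemma eventually_atom_filter: "eventually P (atom_filter E) \<longleftrightarrow> {i \<in> E. \<not> P i} \<in> F"
  unfolding atom_filter_def
proof (rule eventually_Abs_filter, rule is_filter.intro)
  show "{i \<in> E. \<not> (P i \<and> Q i)} \<in> F" if "{i \<in> E. \<not> P i} \<in> F" "{i \<in> E. \<not> Q i} \<in> F" for P Q
    by (rule subset_mem[OF union_mem[OF that]]) auto
  show "{i \<in> E. \<not> Q i} \<in> F" if "\<forall>i. P i \<longrightarrow> Q i" "{i \<in> E. \<not> P i} \<in> F" for P Q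
    by (rule subset_mem[OF that(2)]) (use that(1) in auto)
qed simp

lemma ultrafilter_atom_filter:
  assumes "atom E" "E \<subseteq> I"
  shows "ultrafilter_on I (atom_filter E)"
  unfolding ultrafilter_on_def trivial_limit_def eventually_atom_filter
proof (intro conjI allI impI)
  have empty: "{i \<in> E. i \<notin> I} = {}"
    using assms(2) by auto
  show "{i \<in> E. i \<notin> I} \<in> F"
    unfolding empty by simp
  show "\<not> {i \<in> E. \<not> False} \<in> F"
    using assms(1) by (simp add: atom_def)
  fix A assume "A \<subseteq> I"
  have "E \<inter> A \<in> F \<or> E - E \<inter> A \<in> F"
    using assms(1) by (simp add: atom_def)
  moreover have "{i \<in> E. i \<notin> A} = E - E \<inter> A" "{i \<in> E. i \<notin> I - A} = E \<inter> A"
    using assms(2) by auto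
  ultimately show "{i \<in> E. i \<notin> A} \<in> F \<or> {i \<in> E. i \<notin> I - A} \<in> F"
    by auto
qed

end

section \<open>Direct products and their maps to ultraproducts\<close>

locale nonassoc_ring_family =
  fixes I :: "'i set" and R :: "'i \<Rightarrow> ('a, 'm) ring_scheme"
  assumes factor_ring: "\<And>i. i \<in> I \<Longrightarrow> nonassoc_ring (R i)"
begin

abbreviation P :: "('i \<Rightarrow> 'a) ring" where "P \<equiv> ring_product I R"

sublocale P: nonassoc_ring P
  using factor_ring by (rule ring_product_nonassoc_ring)

lemma factor_group: "i \<in> I \<Longrightarrow> abelian_group (R i)"
  using factor_ring by (simp add: nonassoc_ring_def)

lemma factor_monoid: "i \<in> I \<Longrightarrow> abelian_monoid (R i)"
  using factor_group by (simp add: abelian_group_def)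

lemmas factor_simps [simp] =
  abelian_monoid.zero_closed[OF factor_monoid] abelian_monoid.l_zero[OF factor_monoid]
  abelian_monoid.r_zero[OF factor_monoid]
  nonassoc_ring.l_null[OF factor_ring] nonassoc_ring.r_null[OF factor_ring]

lemma minus_zero: "i \<in> I \<Longrightarrow> \<ominus>\<^bsub>R i\<^esub> \<zero>\<^bsub>R i\<^esub> = \<zero>\<^bsub>R i\<^esub>"
  by (simp add: abelian_group.minus_equality factor_group)

lemma carrier_P_component [simp]: "x \<in> carrier P \<Longrightarrow> i \<in> I \<Longrightarrow> x i \<in> carrier (R i)"
  by (auto simp: ring_product_def)

lemma P_component [simp]:
  assumes "i \<in> I"
  shows "(x \<oplus>\<^bsub>P\<^esub> y) i = x i \<oplus>\<^bsub>R i\<^esub> y i" "(x \<otimes>\<^bsub>P\<^esub> y) i = x i \<otimes>\<^bsub>R i\<^esub> y i" "\<zero>\<^bsub>P\<^esub> i = \<zero>\<^bsub>R i\<^esub>"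
  using assms by (auto simp: ring_product_def)

lemma P_neg_component [simp]:
  assumes x: "x \<in> carrier P" and i: "i \<in> I"
  shows "(\<ominus>\<^bsub>P\<^esub> x) i = \<ominus>\<^bsub>R i\<^esub> x i"
proof -
  have "(\<ominus>\<^bsub>P\<^esub> x) i \<oplus>\<^bsub>R i\<^esub> x i = \<zero>\<^bsub>R i\<^esub>"
    using P.l_neg[OF x] i by (metis P_component(1,3))
  then show ?thesis
    using abelian_group.minus_equality[OF factor_group[OF i]] x i by (metis P.a_inv_closed carrier_P_component)
qed

lemma P_eqI:
  assumes "x \<in> carrier P" "y \<in> carrier P" "\<And>i. i \<in> I \<Longrightarrow> x i = y i"
  shows "x = y"
  using assms by (auto simp: ring_product_def intro: PiE_ext)

lemma P_memI:
  assumes "\<And>i. i \<in> I \<Longrightarrow> c i \<in> carrier (R i)"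
  shows "(\<lambda>i\<in>I. c i) \<in> carrier P"
  using assms by (auto simp: ring_product_def)

lemma ultra_null_coset_hom:
  assumes U: "ultrafilter_on I U"
  shows "(\<lambda>x. ultra_null I R U +>\<^bsub>P\<^esub> x) \<in> nonassoc_ring_hom P (ultraproduct I R U)"
  unfolding ultraproduct_def
proof (rule P.coset_map_hom)
  have inI: "eventually (\<lambda>i. i \<in> I) U"
    using U by (simp add: ultrafilter_on_def)
  show "additive_subgroup (ultra_null I R U) P"
  proof (rule P.additive_subgroupI)
    show "\<zero>\<^bsub>P\<^esub> \<in> ultra_null I R U"
      using inI by (auto simp: ultra_null_def elim: eventually_mono)
  next
    fix x y assume "x \<in> ultra_null I R U" "y \<in> ultra_null I R U"
    then have xy: "x \<in> carrier P" "y \<in> carrier P" "eventually (\<lambda>i. x i = \<zero>\<^bsub>R i\<^esub>) U"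
        "eventually (\<lambda>i. y i = \<zero>\<^bsub>R i\<^esub>) U"
      by (auto simp: ultra_null_def)
    have "eventually (\<lambda>i. (x \<oplus>\<^bsub>P\<^esub> y) i = \<zero>\<^bsub>R i\<^esub>) U"
      using xy(3,4) inI by eventually_elim simp
    then show "x \<oplus>\<^bsub>P\<^esub> y \<in> ultra_null I R U"
      using xy by (simp add: ultra_null_def)
  next
    fix x assume "x \<in> ultra_null I R U"
    then have x: "x \<in> carrier P" "eventually (\<lambda>i. x i = \<zero>\<^bsub>R i\<^esub>) U"
      by (auto simp: ultra_null_def)
    have "eventually (\<lambda>i. (\<ominus>\<^bsub>P\<^esub> x) i = \<zero>\<^bsub>R i\<^esub>) U"
      using x(2) inI by eventually_elim (simp add: x minus_zero)
    then show "\<ominus>\<^bsub>P\<^esub> x \<in> ultra_null I R U"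
      using x by (simp add: ultra_null_def)
  qed (auto simp: ultra_null_def)
next
  have inI: "eventually (\<lambda>i. i \<in> I) U"
    using U by (simp add: ultrafilter_on_def)
  fix x n assume x: "x \<in> carrier P" and "n \<in> ultra_null I R U"
  then have n: "n \<in> carrier P" "eventually (\<lambda>i. n i = \<zero>\<^bsub>R i\<^esub>) U"
    by (auto simp: ultra_null_def)
  have "eventually (\<lambda>i. (x \<otimes>\<^bsub>P\<^esub> n) i = \<zero>\<^bsub>R i\<^esub>) U"
    using n(2) inI by eventually_elim (simp add: x)
  then show "x \<otimes>\<^bsub>P\<^esub> n \<in> ultra_null I R U"
    using x n by (simp add: ultra_null_def)
  have "eventually (\<lambda>i. (n \<otimes>\<^bsub>P\<^esub> x) i = \<zero>\<^bsub>R i\<^esub>) U"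
    using n(2) inI by eventually_elim (simp add: x)
  then show "n \<otimes>\<^bsub>P\<^esub> x \<in> ultra_null I R U"
    using x n by (simp add: ultra_null_def)
qed

lemma ultraproducts_map_hom:
  assumes "\<And>j. j < n \<Longrightarrow> ultrafilter_on I (U j)"
  shows "ultraproducts_map I R n U
    \<in> nonassoc_ring_hom P (ring_product {..<n} (\<lambda>j. ultraproduct I R (U j)))"
  using ultra_null_coset_hom[OF assms]
  by (auto simp: nonassoc_ring_hom_def ultraproducts_map_def ring_product_def Pi_iff
      intro!: restrict_ext)

lemma ultraproducts_map_eq_iff:
  assumes "\<And>j. j < n \<Longrightarrow> ultrafilter_on I (U j)" "x \<in> carrier P" "y \<in> carrier P"
  shows "ultraproducts_map I R n U x = ultraproducts_map I R n U y \<longleftrightarrow>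
    (\<forall>j<n. eventually (\<lambda>i. x i = y i) (U j))"
proof -
  have "ultraproducts_map I R n U x = ultraproducts_map I R n U y \<longleftrightarrow>
      (\<forall>j<n. ultra_null I R (U j) +>\<^bsub>P\<^esub> x = ultra_null I R (U j) +>\<^bsub>P\<^esub> y)"
    unfolding ultraproducts_map_def by (auto simp: fun_eq_iff restrict_def)
  then show ?thesis
    using ultra_null_coset_eq_iff[OF factor_ring assms(1) assms(2,3)] by blast
qed

text \<open>
  Ultrafilters that live on disjoint sets \<open>E j\<close> are independent of one another: representatives of the
  components can be put together, each on its own \<open>E j\<close>.
\<close>

lemma ultraproducts_map_onto:
  assumes U: "\<And>j. j < n \<Longrightarrow> ultrafilter_on I (U j)"
    and disj: "disjoint_family_on E {..<n}"
    and EU: "\<And>j. j < n \<Longrightarrow> eventually (\<lambda>i. i \<in> E j) (U j)"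
  shows "ultraproducts_map I R n U ` carrier P
    = carrier (ring_product {..<n} (\<lambda>j. ultraproduct I R (U j)))"
proof (intro equalityI subsetI)
  fix z assume z: "z \<in> carrier (ring_product {..<n} (\<lambda>j. ultraproduct I R (U j)))"
  have "\<forall>j. \<exists>x. j < n \<longrightarrow> x \<in> carrier P \<and> z j = ultra_null I R (U j) +>\<^bsub>P\<^esub> x"
    using z by (fastforce simp: ring_product_def ultraproduct_def FactRing_def A_RCOSETS_def' PiE_iff)
  then obtain x where x: "\<And>j. j < n \<Longrightarrow> x j \<in> carrier P"
      "\<And>j. j < n \<Longrightarrow> z j = ultra_null I R (U j) +>\<^bsub>P\<^esub> x j"
    by metis
  define y where "y = (\<lambda>i\<in>I. if \<exists>j<n. i \<in> E j then x (THE j. j < n \<and> i \<in> E j) i else \<zero>\<^bsub>R i\<^esub>)"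
  have the: "(THE j'. j' < n \<and> i \<in> E j') = j" if "j < n" "i \<in> E j" for i j
    using that disj by (intro the_equality) (auto simp: disjoint_family_on_def)
  have y: "y \<in> carrier P"
    unfolding y_def using x(1) the by (intro P_memI) auto
  have "z = ultraproducts_map I R n U y"
  proof (rule extensionalityI[of _ "{..<n}"])
    show "z \<in> extensional {..<n}"
      using z by (auto simp: ring_product_def PiE_iff)
    fix j assume "j \<in> {..<n}"
    then have j: "j < n" by simp
    have "eventually (\<lambda>i. i \<in> I) (U j)"
      using U[OF j] by (simp add: ultrafilter_on_def)
    with EU[OF j] have "eventually (\<lambda>i. x j i = y i) (U j)"
      by eventually_elim (use the j in \<open>auto simp: y_def\<close>)
    then show "z j = ultraproducts_map I R n U y j"
      using ultra_null_coset_eq_iff[OF factor_ring U[OF j] x(1)[OF j] y] x(2)[OF j] j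
      by (simp add: ultraproducts_map_def)
  qed (simp add: ultraproducts_map_def)
  with y show "z \<in> ultraproducts_map I R n U ` carrier P" by blast
next
  fix z assume "z \<in> ultraproducts_map I R n U ` carrier P"
  then show "z \<in> carrier (ring_product {..<n} (\<lambda>j. ultraproduct I R (U j)))"
    using ultraproducts_map_hom[of n U, OF U] unfolding nonassoc_ring_hom_def by blast
qed

definition supported :: "'i set \<Rightarrow> ('i \<Rightarrow> 'a) \<Rightarrow> bool" where
  "supported A x \<longleftrightarrow> x \<in> carrier P \<and> (\<forall>i\<in>I - A. x i = \<zero>\<^bsub>R i\<^esub>)"

definition cut :: "'i set \<Rightarrow> ('i \<Rightarrow> 'a) \<Rightarrow> 'i \<Rightarrow> 'a" where
  "cut A x = (\<lambda>i\<in>I. if i \<in> A then x i else \<zero>\<^bsub>R i\<^esub>)"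

lemma supported_carrier: "supported A x \<Longrightarrow> x \<in> carrier P"
  by (simp add: supported_def)

lemma supported_cut: "x \<in> carrier P \<Longrightarrow> supported A (cut A x)"
  by (auto simp: supported_def cut_def intro!: P_memI)

lemma cut_decomp: "x \<in> carrier P \<Longrightarrow> cut A x \<oplus>\<^bsub>P\<^esub> cut (- A) x = x"
  using supported_carrier[OF supported_cut, of x A] supported_carrier[OF supported_cut, of x "- A"]
  by (intro P_eqI P.a_closed) (auto simp: cut_def)

lemma supported_mult_cut:
  assumes "supported A x" "y \<in> carrier P"
  shows "x \<otimes>\<^bsub>P\<^esub> cut A y = x \<otimes>\<^bsub>P\<^esub> y" "cut A y \<otimes>\<^bsub>P\<^esub> x = y \<otimes>\<^bsub>P\<^esub> x"
  using assms supported_carrier[OF supported_cut[of y A]]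
  by (auto simp: supported_def cut_def intro!: P_eqI)

end

section \<open>Infinite sums of disjointly supported elements\<close>

locale disjointly_supported = nonassoc_ring_family I R
  for I :: "'i set" and R :: "'i \<Rightarrow> ('a, 'm) ring_scheme" +
  fixes D :: "nat \<Rightarrow> 'i set"
  assumes disjoint_D: "disjoint_family D"
begin

text \<open>The coordinatewise sum \<open>\<Sum>n\<in>S. X n\<close>: at most one summand is nonzero at each index.\<close>

definition glue :: "(nat \<Rightarrow> 'i \<Rightarrow> 'a) \<Rightarrow> nat set \<Rightarrow> 'i \<Rightarrow> 'a" where
  "glue X S = (\<lambda>i\<in>I. if \<exists>n\<in>S. i \<in> D n then X (THE n. i \<in> D n) i else \<zero>\<^bsub>R i\<^esub>)"

lemma glue_off: "i \<in> I \<Longrightarrow> (\<And>n. i \<notin> D n) \<Longrightarrow> glue X S i = \<zero>\<^bsub>R i\<^esub>"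
  by (simp add: glue_def)

lemma mem_D_unique: "i \<in> D m \<Longrightarrow> i \<in> D n \<Longrightarrow> m = n"
  using disjoint_D by (auto simp: disjoint_family_on_def)

lemma glue_on:
  assumes "i \<in> I" "i \<in> D n"
  shows "glue X S i = (if n \<in> S then X n i else \<zero>\<^bsub>R i\<^esub>)"
proof -
  have "(THE m. i \<in> D m) = n"
    using assms(2) mem_D_unique by blast
  moreover have "(\<exists>m\<in>S. i \<in> D m) \<longleftrightarrow> n \<in> S"
    using assms(2) mem_D_unique by blast
  ultimately show ?thesis
    using assms(1) by (simp add: glue_def)
qed

lemma glue_carrier [simp, intro]:
  assumes X: "\<And>n. supported (D n) (X n)"
  shows "glue X S \<in> carrier P"
  unfolding glue_def using supported_carrier[OF X] by (intro P_memI) auto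

lemma D_cases:
  obtains (on) n where "i \<in> D n" | (off) "\<And>n. i \<notin> D n"
  by blast

text \<open>
  Only two shapes of \<open>\<lambda>S. glue X S i\<close> occur at a given \<open>i\<close>, so an identity between glued elements
  is checked on these shapes, where it concerns a single factor \<open>R i\<close>.
\<close>

lemma glue_pointwise:
  assumes "i \<in> I"
    and "\<And>n. i \<in> D n \<Longrightarrow> Q (\<lambda>S. if n \<in> S then X n i else \<zero>\<^bsub>R i\<^esub>) (\<lambda>S. if n \<in> S then Y n i else \<zero>\<^bsub>R i\<^esub>)"
    and "(\<And>n. i \<notin> D n) \<Longrightarrow> Q (\<lambda>S. \<zero>\<^bsub>R i\<^esub>) (\<lambda>S. \<zero>\<^bsub>R i\<^esub>)"
  shows "Q (\<lambda>S. glue X S i) (\<lambda>S. glue Y S i)"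
proof (cases i rule: D_cases)
  case (on n)
  then show ?thesis
    using assms(2)[OF on] glue_on[OF assms(1) on] by simp
next
  case off
  then show ?thesis
    using assms(3)[OF off] glue_off[OF assms(1) off] by simp
qed

context
  fixes X Y :: "nat \<Rightarrow> 'i \<Rightarrow> 'a"
  assumes X: "\<And>n. supported (D n) (X n)" and Y: "\<And>n. supported (D n) (Y n)"
begin

lemma glue_mult_disjoint:
  assumes "S \<inter> T = {}"
  shows "glue X S \<otimes>\<^bsub>P\<^esub> glue Y T = \<zero>\<^bsub>P\<^esub>"
proof (rule P_eqI)
  fix i assume i: "i \<in> I"
  have "glue X S i \<otimes>\<^bsub>R i\<^esub> glue Y T i = \<zero>\<^bsub>R i\<^esub>"
    by (rule glue_pointwise[OF i, where Q = "\<lambda>p q. p S \<otimes>\<^bsub>R i\<^esub> q T = \<zero>\<^bsub>R i\<^esub>"])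
      (use i assms supported_carrier[OF X] supported_carrier[OF Y] in auto)
  then show "(glue X S \<otimes>\<^bsub>P\<^esub> glue Y T) i = \<zero>\<^bsub>P\<^esub> i"
    using i by simp
qed (use X Y in auto)

lemma glue_mult_singleton:
  assumes "S \<inter> T = {n}"
  shows "glue X S \<otimes>\<^bsub>P\<^esub> glue Y T = X n \<otimes>\<^bsub>P\<^esub> Y n"
proof (rule P_eqI)
  fix i assume i: "i \<in> I"
  have "glue X S i \<otimes>\<^bsub>R i\<^esub> glue Y T i = X n i \<otimes>\<^bsub>R i\<^esub> Y n i"
  proof (cases "i \<in> D n")
    case True
    then show ?thesis
      using assms i by (auto simp: glue_on)
  next
    case False
    then have "X n i = \<zero>\<^bsub>R i\<^esub>" "Y n i = \<zero>\<^bsub>R i\<^esub>"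
      using X[of n] Y[of n] i by (auto simp: supported_def)
    moreover have "m \<notin> S \<or> m \<notin> T" if "i \<in> D m" for m
      using that False assms by (metis IntI singletonD)
    ultimately show ?thesis
      by (intro glue_pointwise[OF i, where Q = "\<lambda>p q. p S \<otimes>\<^bsub>R i\<^esub> q T = X n i \<otimes>\<^bsub>R i\<^esub> Y n i"])
        (use i supported_carrier[OF X] supported_carrier[OF Y] in auto)
  qed
  then show "(glue X S \<otimes>\<^bsub>P\<^esub> glue Y T) i = (X n \<otimes>\<^bsub>P\<^esub> Y n) i"
    using i by simp
qed (use X Y in \<open>auto intro: P.m_closed supported_carrier\<close>)

end

context
  fixes X :: "nat \<Rightarrow> 'i \<Rightarrow> 'a"
  assumes X: "\<And>n. supported (D n) (X n)"
begin

text \<open>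
  At every index, both products are the same square \<open>X n i \<otimes> X n i\<close> or both are zero.
\<close>

lemma glue_mult_commute: "glue X S \<otimes>\<^bsub>P\<^esub> glue X T = glue X T \<otimes>\<^bsub>P\<^esub> glue X S"
proof (rule P_eqI)
  fix i assume i: "i \<in> I"
  have "glue X S i \<otimes>\<^bsub>R i\<^esub> glue X T i = glue X T i \<otimes>\<^bsub>R i\<^esub> glue X S i"
    by (rule glue_pointwise[OF i, where Q = "\<lambda>p q. p S \<otimes>\<^bsub>R i\<^esub> p T = p T \<otimes>\<^bsub>R i\<^esub> p S"])
      (use i supported_carrier[OF X] in auto)
  then show "(glue X S \<otimes>\<^bsub>P\<^esub> glue X T) i = (glue X T \<otimes>\<^bsub>P\<^esub> glue X S) i"
    using i by simp
qed (use X in auto)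

lemma glue_add:
  assumes "S \<inter> T = {}"
  shows "glue X S \<oplus>\<^bsub>P\<^esub> glue X T = glue X (S \<union> T)"
proof (rule P_eqI)
  fix i assume i: "i \<in> I"
  have "glue X S i \<oplus>\<^bsub>R i\<^esub> glue X T i = glue X (S \<union> T) i"
    by (rule glue_pointwise[OF i, where Q = "\<lambda>p q. p S \<oplus>\<^bsub>R i\<^esub> p T = p (S \<union> T)"])
      (use i assms supported_carrier[OF X] in auto)
  then show "(glue X S \<oplus>\<^bsub>P\<^esub> glue X T) i = glue X (S \<union> T) i"
    using i by simp
qed (use X in auto)

end

end

section \<open>Homomorphic images of direct products\<close>

locale ring_product_onto = nonassoc_ring_family I R + B: nonassoc_ring B
  for I :: "'i set" and R :: "'i \<Rightarrow> ('a, 'm) ring_scheme" and B :: "('b, 'n) ring_scheme" +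
  fixes f :: "('i \<Rightarrow> 'a) \<Rightarrow> 'b"
  assumes hom: "f \<in> nonassoc_ring_hom P B" and onto: "f ` carrier P = carrier B"
begin

lemma f_closed [simp, intro]: "x \<in> carrier P \<Longrightarrow> f x \<in> carrier B"
  and f_add: "x \<in> carrier P \<Longrightarrow> y \<in> carrier P \<Longrightarrow> f (x \<oplus>\<^bsub>P\<^esub> y) = f x \<oplus>\<^bsub>B\<^esub> f y"
  and f_mult: "x \<in> carrier P \<Longrightarrow> y \<in> carrier P \<Longrightarrow> f (x \<otimes>\<^bsub>P\<^esub> y) = f x \<otimes>\<^bsub>B\<^esub> f y"
  using hom by (auto simp: nonassoc_ring_hom_def)

lemma f_zero: "f \<zero>\<^bsub>P\<^esub> = \<zero>\<^bsub>B\<^esub>"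
  using f_add[of "\<zero>\<^bsub>P\<^esub>" "\<zero>\<^bsub>P\<^esub>"] by (simp add: B.add.l_cancel_one')

abbreviation "Z \<equiv> zero_mult_ideal B"

interpretation Z: abelian_subgroup Z B
  using B.zero_mult_ideal_additive_subgroup B.abelian_group_axioms by (rule abelian_subgroupI3)

definition null_index_sets :: "'i set set" where
  "null_index_sets = {A. \<forall>x. supported A x \<longrightarrow> f x \<in> Z}"

text \<open>
  Closure under unions: an element supported on \<open>A \<union> C\<close> is the sum of its restriction to \<open>A\<close> and
  an element supported on \<open>C\<close>.
\<close>

sublocale null: set_ideal null_index_sets
proof
  have "f x \<in> Z" if "supported {} x" for x
  proof -
    have "x = \<zero>\<^bsub>P\<^esub>"
      using that by (intro P_eqI) (auto simp: supported_def)
    then show ?thesis by (simp add: f_zero)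
  qed
  then show "{} \<in> null_index_sets"
    by (simp add: null_index_sets_def)
next
  fix A C assume "A \<in> null_index_sets" "C \<subseteq> A"
  then show "C \<in> null_index_sets"
    by (auto simp: null_index_sets_def supported_def)
next
  fix A C assume AC: "A \<in> null_index_sets" "C \<in> null_index_sets"
  have "f x \<in> Z" if x: "supported (A \<union> C) x" for x
  proof -
    have xc: "x \<in> carrier P"
      using x by (rule supported_carrier)
    have "supported C (cut (- A) x)"
      using supported_cut[OF xc, of "- A"] x by (auto simp: supported_def cut_def)
    then have "f (cut A x) \<oplus>\<^bsub>B\<^esub> f (cut (- A) x) \<in> Z"
      using AC supported_cut[OF xc, of A] by (intro Z.a_closed) (auto simp: null_index_sets_def)
    then show ?thesis
      using f_add[OF supported_carrier supported_carrier, OF supported_cut[OF xc, of A] supported_cut[OF xc, of "- A"]]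
        cut_decomp[OF xc, of A] by simp
  qed
  then show "A \<union> C \<in> null_index_sets"
    by (simp add: null_index_sets_def)
qed

lemma coset_eq_if_differ_on_null:
  assumes x: "x \<in> carrier P" and y: "y \<in> carrier P" and null: "{i \<in> I. x i \<noteq> y i} \<in> null_index_sets"
  shows "Z +>\<^bsub>B\<^esub> f x = Z +>\<^bsub>B\<^esub> f y"
proof -
  let ?d = "x \<oplus>\<^bsub>P\<^esub> \<ominus>\<^bsub>P\<^esub> y"
  have d: "?d \<in> carrier P" using x y by simp
  have "supported {i \<in> I. x i \<noteq> y i} ?d"
    using x y by (auto simp: supported_def abelian_group.r_neg[OF factor_group])
  then have "f ?d \<in> Z"
    using null by (simp add: null_index_sets_def)
  moreover have "f x = f ?d \<oplus>\<^bsub>B\<^esub> f y"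
    using x y d by (simp add: f_add[symmetric] P.a_assoc P.l_neg)
  ultimately have "f x \<in> Z +>\<^bsub>B\<^esub> f y"
    by (auto simp: a_r_coset_def')
  then show ?thesis
    using Z.a_repr_independence' y by (metis f_closed)
qed

text \<open>
  The ultrafilters are those of the atoms. Well-definedness: if two elements agree almost everywhere
  for each of them, the set where they differ meets every atom, and also the rest of \<open>I\<close>, in
  a null set.
\<close>

lemma factors_if_splits_into_atoms:
  assumes "null.splits_into_atoms I"
  shows "factors_through_ultraproducts I R (B Quot Z) (\<lambda>x. Z +>\<^bsub>B\<^esub> f x)"
proof -
  obtain \<A> where \<A>: "finite \<A>" "disjoint \<A>" "\<Union>\<A> \<subseteq> I" "\<forall>E\<in>\<A>. null.atom E" "I - \<Union>\<A> \<in> null_index_sets"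
    using assms unfolding null.splits_into_atoms_def by blast
  obtain n E where "bij_betw E {..<n::nat} \<A>"
    using ex_bij_betw_nat_finite[OF \<A>(1)] by (auto simp: atLeast0LessThan)
  then have E: "inj_on E {..<n}" "\<A> = E ` {..<n}"
    by (auto simp: bij_betw_def)
  have disj: "disjoint_family_on E {..<n}"
    unfolding disjoint_family_on_def
  proof (intro ballI impI)
    fix j k assume "j \<in> {..<n}" "k \<in> {..<n}" "j \<noteq> k"
    then have "E j \<in> \<A>" "E k \<in> \<A>" "E j \<noteq> E k"
      using E by (auto dest: inj_onD)
    then show "E j \<inter> E k = {}"
      using \<A>(2) by (simp add: disjoint_def)
  qed
  define U where "U j = null.atom_filter (E j)" for j
  have U: "ultrafilter_on I (U j)" if "j < n" for j
    unfolding U_def using \<A>(3,4) that E(2) by (intro null.ultrafilter_atom_filter) auto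
  have EU: "eventually (\<lambda>i. i \<in> E j) (U j)" for j
    by (simp add: U_def null.eventually_atom_filter)
  have well_defined: "Z +>\<^bsub>B\<^esub> f x = Z +>\<^bsub>B\<^esub> f y"
    if xy: "x \<in> carrier P" "y \<in> carrier P" and eq: "ultraproducts_map I R n U x = ultraproducts_map I R n U y"
    for x y
  proof -
    have "\<forall>j<n. {i \<in> E j. x i \<noteq> y i} \<in> null_index_sets"
      using eq ultraproducts_map_eq_iff[of n U x y] U xy by (simp add: U_def null.eventually_atom_filter)
    then have "(I - \<Union>\<A>) \<union> (\<Union>j\<in>{..<n}. {i \<in> E j. x i \<noteq> y i}) \<in> null_index_sets"
      by (intro null.union_mem \<A>(5) null.finite_Union_mem) auto
    then have "{i \<in> I. x i \<noteq> y i} \<in> null_index_sets"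
      by (rule null.subset_mem) (auto simp: E(2))
    then show ?thesis
      using xy by (intro coset_eq_if_differ_on_null)
  qed
  have "\<exists>g \<in> nonassoc_ring_hom (ring_product {..<n} (\<lambda>j. ultraproduct I R (U j))) (B Quot Z).
      \<forall>x \<in> carrier P. Z +>\<^bsub>B\<^esub> f x = g (ultraproducts_map I R n U x)"
  proof (rule nonassoc_ring_hom_factor[OF P.nonassoc_ring_axioms])
    show "ultraproducts_map I R n U \<in> nonassoc_ring_hom P (ring_product {..<n} (\<lambda>j. ultraproduct I R (U j)))"
      using U by (rule ultraproducts_map_hom)
    show "ultraproducts_map I R n U ` carrier P = carrier (ring_product {..<n} (\<lambda>j. ultraproduct I R (U j)))"
      using U disj EU by (rule ultraproducts_map_onto)
    show "(\<lambda>x. Z +>\<^bsub>B\<^esub> f x) \<in> nonassoc_ring_hom P (B Quot Z)"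
      using hom B.zero_mult_ideal_coset_hom by (rule nonassoc_ring_hom_comp)
  qed (rule well_defined)
  then show ?thesis
    unfolding factors_through_ultraproducts_def using U by blast
qed

text \<open>
  A nonzero product with \<open>f x\<close> may have \<open>f x\<close> on the left or on the right; the roles of the two
  elements are exchanged in the second case.
\<close>

lemma not_null_obtains_product:
  assumes "A \<notin> null_index_sets"
  shows "\<exists>x y. supported A x \<and> supported A y \<and> f x \<otimes>\<^bsub>B\<^esub> f y \<noteq> \<zero>\<^bsub>B\<^esub>"
proof -
  obtain x where x: "supported A x" "f x \<notin> Z"
    using assms unfolding null_index_sets_def by blast
  note xc = supported_carrier[OF x(1)]
  obtain b where b: "b \<in> carrier B" "f x \<otimes>\<^bsub>B\<^esub> b \<noteq> \<zero>\<^bsub>B\<^esub> \<or> b \<otimes>\<^bsub>B\<^esub> f x \<noteq> \<zero>\<^bsub>B\<^esub>"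
    using x(2) f_closed[OF xc] unfolding zero_mult_ideal_def by blast
  obtain y where y: "y \<in> carrier P" "b = f y"
    using b(1) onto by blast
  note c = supported_cut[OF y(1), of A]
  have "f x \<otimes>\<^bsub>B\<^esub> f (cut A y) = f x \<otimes>\<^bsub>B\<^esub> b" "f (cut A y) \<otimes>\<^bsub>B\<^esub> f x = b \<otimes>\<^bsub>B\<^esub> f x"
    using supported_mult_cut[OF x(1) y(1)] supported_carrier[OF c] xc y by (simp_all add: f_mult[symmetric])
  then show ?thesis
    using b(2) x(1) c by metis
qed

end

theorem theorem37:
  fixes B :: "('b, 'n) ring_scheme"
    and I :: "'i set"
    and R :: "'i \<Rightarrow> ('a, 'm) ring_scheme"
    and f :: "('i \<Rightarrow> 'a) \<Rightarrow> 'b"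
  assumes "nonassoc_ring B"
    and "\<And>i. i \<in> I \<Longrightarrow> nonassoc_ring (R i)"
    and "f \<in> nonassoc_ring_hom (ring_product I R) B"
    and "f ` carrier (ring_product I R) = carrier B"
    and "\<not> factors_through_ultraproducts I R (B Quot zero_mult_ideal B)
           (\<lambda>x. zero_mult_ideal B +>\<^bsub>B\<^esub> f x)"
  shows "\<exists>a b :: nat set \<Rightarrow> 'b.
    (\<forall>S. a S \<in> carrier B \<and> b S \<in> carrier B) \<and>
    (\<forall>S T. a S \<otimes>\<^bsub>B\<^esub> a T = a T \<otimes>\<^bsub>B\<^esub> a S \<and> b S \<otimes>\<^bsub>B\<^esub> b T = b T \<otimes>\<^bsub>B\<^esub> b S) \<and>
    (\<forall>S T. S \<inter> T = {} \<longrightarrow>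
       a S \<oplus>\<^bsub>B\<^esub> a T = a (S \<union> T) \<and> b S \<oplus>\<^bsub>B\<^esub> b T = b (S \<union> T) \<and>
       a S \<otimes>\<^bsub>B\<^esub> a T = \<zero>\<^bsub>B\<^esub> \<and> a S \<otimes>\<^bsub>B\<^esub> b T = \<zero>\<^bsub>B\<^esub> \<and>
       b S \<otimes>\<^bsub>B\<^esub> a T = \<zero>\<^bsub>B\<^esub> \<and> b S \<otimes>\<^bsub>B\<^esub> b T = \<zero>\<^bsub>B\<^esub>) \<and>
    (\<forall>S T. card (S \<inter> T) = 1 \<longrightarrow> a S \<otimes>\<^bsub>B\<^esub> b T \<noteq> \<zero>\<^bsub>B\<^esub>)"
proof -
  interpret ring_product_onto I R B f
    by (intro ring_product_onto.intro nonassoc_ring_family.intro ring_product_onto_axioms.intro) (fact assms)+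
  have "\<not> null.splits_into_atoms I"
    using assms(5) factors_if_splits_into_atoms by blast
  then obtain D :: "nat \<Rightarrow> 'i set" where D: "disjoint_family D" "\<And>n. D n \<notin> null_index_sets"
    using null.splits_into_atoms_or_disjoint_sequence[of I] by blast
  interpret disjointly_supported I R D
    by unfold_locales (rule D(1))
  obtain X Y where X: "\<And>n. supported (D n) (X n)" and Y: "\<And>n. supported (D n) (Y n)"
    and XY: "\<And>n. f (X n) \<otimes>\<^bsub>B\<^esub> f (Y n) \<noteq> \<zero>\<^bsub>B\<^esub>"
    using not_null_obtains_product[OF D(2)] by metis
  have nonzero: "f (glue X S) \<otimes>\<^bsub>B\<^esub> f (glue Y T) \<noteq> \<zero>\<^bsub>B\<^esub>" if card: "card (S \<inter> T) = 1" for S T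
  proof -
    obtain n where "S \<inter> T = {n}"
      using card by (auto simp: card_1_singleton_iff)
    then show ?thesis
      using glue_mult_singleton[OF X Y] XY[of n] X Y supported_carrier[OF X] supported_carrier[OF Y]
      by (simp add: f_mult[symmetric])
  qed
  have "f (glue V S) \<otimes>\<^bsub>B\<^esub> f (glue W T) = \<zero>\<^bsub>B\<^esub>"
    if "S \<inter> T = {}" "\<And>n. supported (D n) (V n)" "\<And>n. supported (D n) (W n)" for S T V W
    using that glue_mult_disjoint[of V W S T] by (simp add: f_mult[symmetric] f_zero)
  moreover have "f (glue V S) \<oplus>\<^bsub>B\<^esub> f (glue V T) = f (glue V (S \<union> T))"
    if "S \<inter> T = {}" "\<And>n. supported (D n) (V n)" for S T V
    using that glue_add[of V S T] by (simp add: f_add[symmetric])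
  moreover have "f (glue V S) \<otimes>\<^bsub>B\<^esub> f (glue V T) = f (glue V T) \<otimes>\<^bsub>B\<^esub> f (glue V S)"
    if "\<And>n. supported (D n) (V n)" for S T V
    using that glue_mult_commute[of V S T] by (simp add: f_mult[symmetric])
  ultimately show ?thesis
    using X Y nonzero
    by (intro exI[of _ "\<lambda>S. f (glue X S)"] exI[of _ "\<lambda>S. f (glue Y S)"]) simp
qed

end
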